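(* The centralizer $Z_{\tilde{\mathfrak H}}(T_1)=\{U\in\tilde{\mathfrak H}: UT_1=T_1U\}$ of $T_1$ in $\tilde{\mathfrak H}$ is equal to $\widetilde{AW}(3,Q_0)$ (regarded as a subalgebra of $\tilde{\mathfrak H}$).
   Context: All algebras are associative unital algebras over $\mathbb C$. Parameters: $q,a,b,c,d\in\mathbb C$ with $q\ne0$, $q^m\ne1$ for $m=1,2,\ldots$; $a,b,c,d\ne0$; $abcd\ne q^{-m}$ for $m=0,1,2,\ldots$; and $ab\ne1$. Let $e_1=a+b+c+d$, $e_2=ab+ac+bc+ad+bd+cd$, $e_3=abc+abd+acd+bcd$, $e_4=abcd$. Structure constants: $B=(1-q^{-1})^2(e_3+qe_1)$, $C_0=(q-q^{-1})^2$, $C_1=q^{-1}(q-q^{-1})^2e_4$, $D_0=-q^{-3}(1-q)^2(1+q)(e_4+qe_2+q^2)$, $D_1=-q^{-3}(1-q)^2(1+q)(e_1e_4+qe_3)$, $$Q_0=q^{-4}(1-q)^2\bigl(q^4(e_4-e_2)+q^3(e_1^2-e_1e_3-2e_2)-q^2(e_2e_4+2e_4+e_2)+q(e_3^2-2e_2e_4-e_1e_3)+e_4(1-e_2)\bigr),$$ $E=-q^{-2}(1-q)^3(c+d)$, $F_0=q^{-3}(1-q)^3(1+q)(cd+q)$, $F_1=q^{-3}(1-q)^3(1+q)(a+b)cd$, $$G=-q^{-4}(1-q)^3\bigl((a+b)(c+d)(cd(q^2+1)+q)-q(ab+1)((c^2+d^2)(q+1)-cd)+(cd+e_4)(q^2+1)+(e_2+e_4-ab)q^3\bigr).$$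 The algebra $\widetilde{AW}(3,Q_0)$ is generated by $K_0,K_1,T_1$ such that $(T_1+ab)(T_1+1)=0$, $T_1$ commutes with $K_0,K_1$, and $$(q+q^{-1})K_1K_0K_1-K_1^2K_0-K_0K_1^2=BK_1+C_0K_0+D_0+EK_1(T_1+ab)+F_0(T_1+ab),$$ $$(q+q^{-1})K_0K_1K_0-K_0^2K_1-K_1K_0^2=BK_0+C_1K_1+D_1+EK_0(T_1+ab)+F_1(T_1+ab),$$ $$Q_0=(K_1K_0)^2-(q^2+1+q^{-2})K_0(K_1K_0)K_1+(q+q^{-1})K_0^2K_1^2+(q+q^{-1})(C_0K_0^2+C_1K_1^2)$$ $$+\bigl(B+E(T_1+ab)\bigr)\bigl((q+1+q^{-1})K_0K_1+K_1K_0\bigr)+(q+1+q^{-1})\bigl(D_0+F_0(T_1+ab)\bigr)K_0$$ $$+(q+1+q^{-1})\bigl(D_1+F_1(T_1+ab)\bigr)K_1+G(T_1+ab).$$ The double affine Hecke algebra $\tilde{\mathfrak H}$ (type $(C_1^\vee,C_1)$) is generated by $T_1,Y,Y^{-1},Z,Z^{-1}$ with relations $YY^{-1}=1=Y^{-1}Y$, $ZZ^{-1}=1=Z^{-1}Z$ and $T_1^2=-(ab+1)T_1-ab$, $T_1Z=Z^{-1}T_1+(ab+1)Z^{-1}-(a+b)$, $T_1Z^{-1}=ZT_1-(ab+1)Z^{-1}+(a+b)$, $T_1Y=q^{-1}abcd\,Y^{-1}T_1-(ab+1)Y+ab(1+q^{-1}cd)$, $T_1Y^{-1}=q(abcd)^{-1}YT_1+q(abcd)^{-1}(1+ab)Y-q(cd)^{-1}(1+q^{-1}cd)$,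 $YZ=qZY+(1+ab)cd\,Z^{-1}Y^{-1}T_1-(a+b)cd\,Y^{-1}T_1-(1+q^{-1}cd)Z^{-1}T_1-(1-q)(1+ab)(1+q^{-1}cd)Z^{-1}+(c+d)T_1+(1-q)(a+b)(1+q^{-1}cd)$, $YZ^{-1}=q^{-1}Z^{-1}Y-q^{-2}(1+ab)cd\,Z^{-1}Y^{-1}T_1+q^{-2}(a+b)cd\,Y^{-1}T_1+q^{-1}(1+q^{-1}cd)Z^{-1}T_1-q^{-1}(c+d)T_1$, $Y^{-1}Z=q^{-1}ZY^{-1}-q(ab)^{-1}(1+ab)Z^{-1}Y^{-1}T_1+(ab)^{-1}(a+b)Y^{-1}T_1+q(abcd)^{-1}(1+q^{-1}cd)Z^{-1}T_1+q(abcd)^{-1}(1-q)(1+ab)(1+q^{-1}cd)Z^{-1}-(abcd)^{-1}(c+d)T_1-(abcd)^{-1}(1-q)(1+ab)(c+d)$, $Y^{-1}Z^{-1}=qZ^{-1}Y^{-1}+q(ab)^{-1}(1+ab)Z^{-1}Y^{-1}T_1-(ab)^{-1}(a+b)Y^{-1}T_1-q^2(abcd)^{-1}(1+q^{-1}cd)Z^{-1}T_1+q(abcd)^{-1}(c+d)T_1$. It is known (earlier work) that there is a unique injective algebra homomorphism $\widetilde{AW}(3,Q_0)\to\tilde{\mathfrak H}$ with $K_0\mapsto Y+q^{-1}abcd\,Y^{-1}$, $K_1\mapsto Z+Z^{-1}$, $T_1\mapsto T_1$; via it $\widetilde{AW}(3,Q_0)$ is regarded as a subalgebra of $\tilde{\mathfrak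 H}$ (namely the subalgebra generated by $Y+q^{-1}abcd\,Y^{-1}$, $Z+Z^{-1}$, $T_1$). *)

theory Defs
  imports Complex_Main "HOL-Library.Poly_Mapping"
    "HOL-Algebra.QuotRing" "HOL-Algebra.Generated_Rings"
begin

section \<open>Complex algebras presented by generators and relations\<close>

text \<open>Words, written additively because multiplication of \<^type>\<open>poly_mapping\<close>s is
  convolution with respect to \<^class>\<open>monoid_add\<close> (not necessarily commutative).\<close>

datatype 'g word = Word (letters: "'g list")

instantiation word :: (type) monoid_add
begin

definition zero_word :: "'a word" where
  "0 = Word []"

definition plus_word :: "'a word \<Rightarrow> 'a word \<Rightarrow> 'a word" where
  "v + w = Word (letters v @ letters w)"

instance
  by standard (simp_all add: zero_word_def plus_word_def)

end

type_synonym 'g free_alg = "'g word \<Rightarrow>\<^sub>0 complex"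

definition gen :: "'g \<Rightarrow> 'g free_alg" where
  "gen g = Poly_Mapping.single (Word [g]) 1"

definition cst :: "complex \<Rightarrow> 'g free_alg" where
  "cst z = Poly_Mapping.single 0 z"

abbreviation scal :: "complex \<Rightarrow> 'g free_alg \<Rightarrow> 'g free_alg" (infixr \<open>*\<^sub>C\<close> 75) where
  "z *\<^sub>C p \<equiv> cst z * p"

definition free_ring :: "'g free_alg ring" where
  "free_ring = \<lparr>carrier = UNIV, mult = (*), one = 1, zero = 0, add = (+)\<rparr>"

lemma ring_free_ring: "ring free_ring"
proof (rule ringI)
  show "abelian_group (free_ring :: 'g free_alg ring)"
  proof (rule abelian_groupI)
    fix x :: "'g free_alg"
    assume "x \<in> carrier free_ring"
    show "\<exists>y\<in>carrier free_ring. y \<oplus>\<^bsub>free_ring\<^esub> x = \<zero>\<^bsub>free_ring\<^esub>"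
      by (rule bexI[of _ "- x"]) (simp_all add: free_ring_def)
  qed (simp_all add: free_ring_def add_ac)
  show "Group.monoid (free_ring :: 'g free_alg ring)"
    by (rule monoidI) (simp_all add: free_ring_def mult.assoc)
qed (simp_all add: free_ring_def distrib_left distrib_right)

text \<open>A pair \<open>(l, r)\<close> stands for the relation \<open>l = r\<close>. The ideal is two-sided, and it is a
  complex subspace because the free algebra contains the scalars \<^term>\<open>cst z\<close>.\<close>

definition rel_ideal :: "('g free_alg \<times> 'g free_alg) set \<Rightarrow> 'g free_alg set" where
  "rel_ideal R = Idl\<^bsub>free_ring\<^esub> {l - r | l r. (l, r) \<in> R}"

definition pres_alg :: "('g free_alg \<times> 'g free_alg) set \<Rightarrow> 'g free_alg set ring" where
  "pres_alg R = free_ring Quot rel_ideal R"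

definition cls :: "('g free_alg \<times> 'g free_alg) set \<Rightarrow> 'g free_alg \<Rightarrow> 'g free_alg set" where
  "cls R p = rel_ideal R +>\<^bsub>free_ring\<^esub> p"

lemma ideal_rel_ideal: "ideal (rel_ideal R) free_ring"
  unfolding rel_ideal_def
  by (rule ring.genideal_ideal[OF ring_free_ring]) (simp add: free_ring_def)

lemma ring_pres_alg: "ring (pres_alg R)"
  unfolding pres_alg_def by (rule ideal.quotient_is_ring[OF ideal_rel_ideal])

definition alg_hom ::
  "('g free_alg \<times> 'g free_alg) set \<Rightarrow> ('h free_alg \<times> 'h free_alg) set
    \<Rightarrow> ('g free_alg set \<Rightarrow> 'h free_alg set) set" where
  "alg_hom R S = {\<phi> \<in> ring_hom (pres_alg R) (pres_alg S). \<forall>z. \<phi> (cls R (cst z)) = cls S (cst z)}"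

definition gen_subalg ::
  "('g free_alg \<times> 'g free_alg) set \<Rightarrow> 'g free_alg set set \<Rightarrow> 'g free_alg set set" where
  "gen_subalg R X = generate_ring (pres_alg R) (range (\<lambda>z. cls R (cst z)) \<union> X)"

definition centralizer :: "('a, 'm) ring_scheme \<Rightarrow> 'a \<Rightarrow> 'a set" where
  "centralizer A x = {u \<in> carrier A. u \<otimes>\<^bsub>A\<^esub> x = x \<otimes>\<^bsub>A\<^esub> u}"


section \<open>The algebras \<open>AW(3,Q\<^sub>0)\<close> (extended by \<open>T\<^sub>1\<close>) and the double affine Hecke algebra\<close>

datatype aw_gen = AK0 | AK1 | AT1

datatype daha_gen = HT1 | HY | HYi | HZ | HZi

context
  fixes q a b c d :: complex
begin

definition e1 :: complex where "e1 = a + b + c + d"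
definition e2 :: complex where "e2 = a*b + a*c + b*c + a*d + b*d + c*d"
definition e3 :: complex where "e3 = a*b*c + a*b*d + a*c*d + b*c*d"
definition e4 :: complex where "e4 = a*b*c*d"

definition awB :: complex where
  "awB = (1 - inverse q)^2 * (e3 + q*e1)"

definition awC0 :: complex where
  "awC0 = (q - inverse q)^2"

definition awC1 :: complex where
  "awC1 = inverse q * (q - inverse q)^2 * e4"

definition awD0 :: complex where
  "awD0 = - (inverse q ^ 3 * (1 - q)^2 * (1 + q) * (e4 + q*e2 + q^2))"

definition awD1 :: complex where
  "awD1 = - (inverse q ^ 3 * (1 - q)^2 * (1 + q) * (e1*e4 + q*e3))"

definition awQ0 :: complex where
  "awQ0 = inverse q ^ 4 * (1 - q)^2 *
     (q^4 * (e4 - e2) + q^3 * (e1^2 - e1*e3 - 2*e2) - q^2 * (e2*e4 + 2*e4 + e2)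
      + q * (e3^2 - 2*e2*e4 - e1*e3) + e4 * (1 - e2))"

definition awE :: complex where
  "awE = - (inverse q ^ 2 * (1 - q)^3 * (c + d))"

definition awF0 :: complex where
  "awF0 = inverse q ^ 3 * (1 - q)^3 * (1 + q) * (c*d + q)"

definition awF1 :: complex where
  "awF1 = inverse q ^ 3 * (1 - q)^3 * (1 + q) * (a + b) * (c*d)"

definition awG :: complex where
  "awG = - (inverse q ^ 4 * (1 - q)^3 *
     ((a + b) * (c + d) * (c*d * (q^2 + 1) + q)
      - q * (a*b + 1) * ((c^2 + d^2) * (q + 1) - c*d)
      + (c*d + e4) * (q^2 + 1) + (e2 + e4 - a*b) * q^3))"

definition aw_rels :: "(aw_gen free_alg \<times> aw_gen free_alg) set" where
  "aw_rels =
    (let K0 = gen AK0; K1 = gen AK1; T = gen AT1;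
         Tab = T + cst (a*b);
         s = q + inverse q; w = q + 1 + inverse q
     in {(Tab * (T + 1), 0),
         (T * K0, K0 * T),
         (T * K1, K1 * T),
         (s *\<^sub>C (K1 * K0 * K1) - K1^2 * K0 - K0 * K1^2,
          awB *\<^sub>C K1 + awC0 *\<^sub>C K0 + cst awD0 + awE *\<^sub>C (K1 * Tab) + awF0 *\<^sub>C Tab),
         (s *\<^sub>C (K0 * K1 * K0) - K0^2 * K1 - K1 * K0^2,
          awB *\<^sub>C K0 + awC1 *\<^sub>C K1 + cst awD1 + awE *\<^sub>C (K0 * Tab) + awF1 *\<^sub>C Tab),
         (cst awQ0,
          (K1 * K0)^2 - (q^2 + 1 + inverse q ^ 2) *\<^sub>C (K0 * (K1 * K0) * K1)
          + s *\<^sub>C (K0^2 * K1^2) + s *\<^sub>C (awC0 *\<^sub>C K0^2 + awC1 *\<^sub>C K1^2)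
          + (cst awB + awE *\<^sub>C Tab) * (w *\<^sub>C (K0 * K1) + K1 * K0)
          + w *\<^sub>C ((cst awD0 + awF0 *\<^sub>C Tab) * K0)
          + w *\<^sub>C ((cst awD1 + awF1 *\<^sub>C Tab) * K1)
          + awG *\<^sub>C Tab)})"

definition daha_rels :: "(daha_gen free_alg \<times> daha_gen free_alg) set" where
  "daha_rels =
    (let T = gen HT1; Y = gen HY; Yi = gen HYi; Z = gen HZ; Zi = gen HZi;
         p = a*b*c*d; u = 1 + inverse q * (c*d)
     in {(Y * Yi, 1), (Yi * Y, 1), (Z * Zi, 1), (Zi * Z, 1),
         (T^2, - ((a*b + 1) *\<^sub>C T) - cst (a*b)),
         (T * Z, Zi * T + (a*b + 1) *\<^sub>C Zi - cst (a + b)),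
         (T * Zi, Z * T - (a*b + 1) *\<^sub>C Zi + cst (a + b)),
         (T * Y, (inverse q * p) *\<^sub>C (Yi * T) - (a*b + 1) *\<^sub>C Y + cst (a*b * u)),
         (T * Yi, (q * inverse p) *\<^sub>C (Y * T) + (q * inverse p * (1 + a*b)) *\<^sub>C Y
            - cst (q * inverse (c*d) * u)),
         (Y * Z, q *\<^sub>C (Z * Y) + ((1 + a*b) * (c*d)) *\<^sub>C (Zi * Yi * T)
            - ((a + b) * (c*d)) *\<^sub>C (Yi * T) - u *\<^sub>C (Zi * T)
            - ((1 - q) * (1 + a*b) * u) *\<^sub>C Zi + (c + d) *\<^sub>C T
            + cst ((1 - q) * (a + b) * u)),
         (Y * Zi, inverse q *\<^sub>C (Zi * Y) - (inverse q ^ 2 * (1 + a*b) * (c*d)) *\<^sub>C (Zi * Yi * T)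
            + (inverse q ^ 2 * (a + b) * (c*d)) *\<^sub>C (Yi * T) + (inverse q * u) *\<^sub>C (Zi * T)
            - (inverse q * (c + d)) *\<^sub>C T),
         (Yi * Z, inverse q *\<^sub>C (Z * Yi) - (q * inverse (a*b) * (1 + a*b)) *\<^sub>C (Zi * Yi * T)
            + (inverse (a*b) * (a + b)) *\<^sub>C (Yi * T) + (q * inverse p * u) *\<^sub>C (Zi * T)
            + (q * inverse p * (1 - q) * (1 + a*b) * u) *\<^sub>C Zi
            - (inverse p * (c + d)) *\<^sub>C T - cst (inverse p * (1 - q) * (1 + a*b) * (c + d))),
         (Yi * Zi, q *\<^sub>C (Zi * Yi) + (q * inverse (a*b) * (1 + a*b)) *\<^sub>C (Zi * Yi * T)
            - (inverse (a*b) * (a + b)) *\<^sub>C (Yi * T) - (q^2 * inverse p * u) *\<^sub>C (Zi * T)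
            + (q * inverse p * (c + d)) *\<^sub>C T)})"

definition AW :: "aw_gen free_alg set ring" where
  "AW = pres_alg aw_rels"

definition DAHA :: "daha_gen free_alg set ring" where
  "DAHA = pres_alg daha_rels"

definition daha_T1 :: "daha_gen free_alg set" where
  "daha_T1 = cls daha_rels (gen HT1)"

definition daha_K0 :: "daha_gen free_alg set" where
  "daha_K0 = cls daha_rels (gen HY + (inverse q * (a*b*c*d)) *\<^sub>C gen HYi)"

definition daha_K1 :: "daha_gen free_alg set" where
  "daha_K1 = cls daha_rels (gen HZ + gen HZi)"

definition AW_embedding :: "(aw_gen free_alg set \<Rightarrow> daha_gen free_alg set) \<Rightarrow> bool" where
  "AW_embedding \<phi> \<longleftrightarrow>
     \<phi> \<in> alg_hom aw_rels daha_rels \<and> inj_on \<phi> (carrier AW) \<and>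
     \<phi> (cls aw_rels (gen AK0)) = daha_K0 \<and>
     \<phi> (cls aw_rels (gen AK1)) = daha_K1 \<and>
     \<phi> (cls aw_rels (gen AT1)) = daha_T1"

end

end

theory Submission
  imports Defs
begin

text \<open>
  Since \<open>ab \<noteq> 1\<close>, \<open>T\<close> has two distinct eigenvalues, and up to the scalar \<open>2(1 - ab)\<^sup>2\<close> the map
  \<open>h \<mapsto> (2T + ab + 1) h (2T + ab + 1) + (1 - ab)\<^sup>2 h\<close> (below, \<open>E\<close> is half of it) projects the
  double affine Hecke algebra onto the centralizer of \<open>T\<close>. It is a map of bimodules over the
  subalgebra \<open>A\<close> generated by \<open>K\<^sub>0\<close>, \<open>K\<^sub>1\<close>, \<open>T\<close>, so \<open>S = {h. E h \<in> A}\<close> is an \<open>A\<close>-bimodule,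
  and it suffices to show that \<open>S\<close> is everything. Every element is a sum of products \<open>l r\<close> with
  \<open>l\<close> in the subalgebra generated by \<open>Z\<close>, its inverse and \<open>T\<close>, which is contained in \<open>A + A Z\<close>,
  and \<open>r\<close> in the one generated by \<open>Y\<close>, its inverse and \<open>T\<close>, which is contained in \<open>A + Y A\<close>.
  This leaves \<open>1, Y, Z, ZY \<in> S\<close>. For \<open>ZY\<close>, the relations that reorder \<open>Y\<close> with \<open>Z\<close> and with the
  inverse of \<open>Z\<close> reduce modulo \<open>S\<close> to \<open>- ZY T\<^sup>2 = ZY (ab + (ab + 1) T) \<in> S\<close>, because \<open>q\<^sup>2 \<noteq> 1\<close>,
  and \<open>T\<close> is invertible. Instead of elements of the quotient, representatives in the free algebra
  are used, and subsets of the quotient are replaced by their preimages.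
\<close>

section \<open>Presented algebras\<close>

lemma cst_0 [simp]: "cst 0 = 0"
  by (simp add: cst_def)

lemma cst_1 [simp]: "cst 1 = 1"
  by (simp add: cst_def)

lemma cst_uminus: "cst (- x) = - cst x"
  by (simp add: cst_def single_uminus)

lemma cst_diff: "cst (x - y) = cst x - cst y"
  by (simp add: cst_def single_diff)

lemma cst_mult: "cst (x * y) = cst x * cst y"
  by (simp add: cst_def mult_single)

lemma cst_power: "cst (x ^ n) = cst x ^ n"
  by (induction n) (simp_all add: cst_mult)

lemma cst_numeral: "cst (numeral n) = numeral n"
  by (simp add: cst_def)

lemma cst_inverse_cancel: "x \<noteq> 0 \<Longrightarrow> cst (inverse x) * (cst x * p) = p"
  by (simp add: mult.assoc[symmetric] cst_mult[symmetric])

text \<open>Updating at a fresh key is the same as adding a monomial, so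
  \<open>update_induct\<close> becomes an induction whose step is additive.\<close>

lemma poly_mapping_single_induct [case_names zero add]:
  fixes p :: "'a \<Rightarrow>\<^sub>0 'b::monoid_add"
  assumes "P 0" and "\<And>k v p. P p \<Longrightarrow> P (Poly_Mapping.single k v + p)"
  shows "P p"
proof (induction p rule: update_induct)
  case const
  show ?case by (rule assms(1))
next
  case (update p k v)
  have "Poly_Mapping.update k v p = Poly_Mapping.single k v + p"
    using update(1)
    by (intro poly_mapping_eqI)
      (auto simp: lookup_update lookup_add lookup_single when_def in_keys_iff)
  then show ?case using assms(2)[OF update(3)] by simp
qed

text \<open>Scalars are central because \<open>cst z\<close> sits at the empty word, the unit for
  concatenation, and complex numbers commute.\<close>

lemma cst_commute: "p * cst z = cst z * (p :: 'g free_alg)"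
proof (induction p rule: poly_mapping_single_induct)
  case zero
  show ?case by simp
next
  case (add k v p)
  then show ?case
    by (simp add: distrib_left distrib_right cst_def mult_single mult.commute)
qed

lemma cst_left_commute: "p * (cst z * r) = cst z * (p * (r :: 'g free_alg))"
  by (metis cst_commute mult.assoc)

text \<open>With \<open>rel_ideal R\<close> included among the generators this becomes the preimage
  of a subalgebra of the quotient.\<close>

inductive_set subalg :: "'g free_alg set \<Rightarrow> 'g free_alg set" for X where
  cst: "cst z \<in> subalg X"
| base: "x \<in> X \<Longrightarrow> x \<in> subalg X"
| add: "x \<in> subalg X \<Longrightarrow> y \<in> subalg X \<Longrightarrow> x + y \<in> subalg X"
| mult: "x \<in> subalg X \<Longrightarrow> y \<in> subalg X \<Longrightarrow> x * y \<in> subalg X"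

lemma subalg_range_gen: "subalg (range gen) = (UNIV :: 'g free_alg set)"
proof -
  have w: "Poly_Mapping.single (Word w) z \<in> subalg (range gen)" for w :: "'g list" and z
  proof (induction w)
    case Nil
    then show ?case using subalg.cst[of z] by (simp add: cst_def zero_word_def)
  next
    case (Cons g w)
    have "Poly_Mapping.single (Word (g # w)) z = gen g * Poly_Mapping.single (Word w) z"
      by (simp add: gen_def mult_single plus_word_def)
    then show ?case using Cons by (auto intro: subalg.mult subalg.base)
  qed
  have "p \<in> subalg (range gen)" for p :: "'g free_alg"
  proof (induction p rule: poly_mapping_single_induct)
    case zero
    show ?case using subalg.cst[of 0] by simp
  next
    case (add k v p)
    then show ?case by (cases k) (auto intro: subalg.add w)
  qed
  then show ?thesis by blast
qed

section \<open>Complex subspaces of the free algebra\<close>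

definition csubspace :: "'g free_alg set \<Rightarrow> bool" where
  "csubspace V \<longleftrightarrow> 0 \<in> V \<and> (\<forall>x\<in>V. \<forall>y\<in>V. x + y \<in> V) \<and> (\<forall>z. \<forall>x\<in>V. cst z * x \<in> V)"

lemma csubspaceI:
  assumes "0 \<in> V" "\<And>x y. x \<in> V \<Longrightarrow> y \<in> V \<Longrightarrow> x + y \<in> V" "\<And>z x. x \<in> V \<Longrightarrow> cst z * x \<in> V"
  shows "csubspace V"
  using assms by (auto simp: csubspace_def)

lemma
  assumes "csubspace V"
  shows csubspace_0: "0 \<in> V"
    and csubspace_add: "x \<in> V \<Longrightarrow> y \<in> V \<Longrightarrow> x + y \<in> V"
    and csubspace_scale: "x \<in> V \<Longrightarrow> cst z * x \<in> V"
    and csubspace_uminus: "x \<in> V \<Longrightarrow> - x \<in> V"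
    and csubspace_diff: "x \<in> V \<Longrightarrow> y \<in> V \<Longrightarrow> x - y \<in> V"
proof -
  show *: "0 \<in> V" "x \<in> V \<Longrightarrow> y \<in> V \<Longrightarrow> x + y \<in> V" "x \<in> V \<Longrightarrow> cst z * x \<in> V" for x y z
    using assms by (auto simp: csubspace_def)
  show **: "x \<in> V \<Longrightarrow> - x \<in> V" for x
    using *(3)[of x "-1"] by (simp add: cst_uminus)
  show "x \<in> V \<Longrightarrow> y \<in> V \<Longrightarrow> x - y \<in> V"
    using *(2)[of x "- y"] ** by simp
qed

lemmas csubspace_intros =
  csubspace_0 csubspace_add csubspace_scale csubspace_uminus csubspace_diff

text \<open>The way in which relations are applied: if the ideal lies in \<open>V\<close>, each
  relation transports membership in \<open>V\<close> from one side to the other.\<close>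

lemma csubspace_diff_iff:
  assumes "csubspace V" and "x - y \<in> V"
  shows "x \<in> V \<longleftrightarrow> y \<in> V"
  using csubspace_add[OF assms(1) assms(2), of y] csubspace_diff[OF assms(1) _ assms(2), of x]
  by auto

lemma csubspace_scale_iff:
  assumes "csubspace V" and "z \<noteq> 0"
  shows "cst z * x \<in> V \<longleftrightarrow> x \<in> V"
  using csubspace_scale[OF assms(1), of "cst z * x" "inverse z"]
    csubspace_scale[OF assms(1), of x z] assms(2) by (auto simp: cst_inverse_cancel)

lemma csubspace_subalg: "csubspace (subalg X)"
  using subalg.cst[of 0 X] by (intro csubspaceI) (auto intro: subalg.intros)

text \<open>Invariance need only be checked on generators, by associativity and linearity. Starting
  from \<open>v = 1\<close>, it places a whole subalgebra inside \<open>V\<close>.\<close>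

lemma subalg_right_closed:
  assumes V: "csubspace V" and "\<And>v x. v \<in> V \<Longrightarrow> x \<in> X \<Longrightarrow> v * x \<in> V"
    and "x \<in> subalg X" "v \<in> V"
  shows "v * x \<in> V"
  using assms(3,4)
proof (induction arbitrary: v rule: subalg.induct)
  case (cst z)
  then show ?case using csubspace_scale[OF V] by (simp add: cst_commute)
next
  case (mult x y)
  then show ?case by (simp add: mult.assoc[symmetric])
qed (use assms(2) csubspace_add[OF V] in \<open>auto simp: distrib_left\<close>)

lemma subalg_left_closed:
  assumes V: "csubspace V" and "\<And>v x. v \<in> V \<Longrightarrow> x \<in> X \<Longrightarrow> x * v \<in> V"
    and "x \<in> subalg X" "v \<in> V"
  shows "x * v \<in> V"
  using assms(3,4)
proof (induction arbitrary: v rule: subalg.induct)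
  case (mult x y)
  then show ?case by (simp add: mult.assoc)
qed (use assms(2) csubspace_add[OF V] csubspace_scale[OF V] in \<open>auto simp: distrib_right\<close>)

section \<open>The ideal of relations and the class map\<close>

lemma free_ring_minus: "x \<ominus>\<^bsub>free_ring\<^esub> y = x - (y :: 'g free_alg)"
proof -
  interpret ring "free_ring :: 'g free_alg ring" by (rule ring_free_ring)
  have "\<ominus>\<^bsub>free_ring\<^esub> y = - y"
    by (rule minus_equality) (simp_all add: free_ring_def)
  then show ?thesis by (simp add: a_minus_def) (simp add: free_ring_def)
qed

lemma rel_in_rel_ideal: "(l, r) \<in> R \<Longrightarrow> l - r \<in> rel_ideal R"
  unfolding rel_ideal_def
  using ring.genideal_self[OF ring_free_ring, of "{l - r | l r. (l, r) \<in> R}"]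
  by (auto simp: free_ring_def)

lemma
  assumes "x \<in> rel_ideal R"
  shows rel_ideal_mult_left: "y * x \<in> rel_ideal R"
    and rel_ideal_mult_right: "x * y \<in> rel_ideal R"
  using ideal.I_l_closed[OF ideal_rel_ideal assms, of y]
    ideal.I_r_closed[OF ideal_rel_ideal assms, of y]
  by (simp_all add: free_ring_def)

lemma csubspace_rel_ideal: "csubspace (rel_ideal R)"
proof -
  interpret additive_subgroup "rel_ideal R" free_ring
    by (rule ideal.axioms(1)[OF ideal_rel_ideal])
  show ?thesis
    using zero_closed a_closed
    by (intro csubspaceI rel_ideal_mult_left) (simp_all add: free_ring_def)
qed

lemma cls_eq_iff: "cls R x = cls R y \<longleftrightarrow> x - y \<in> rel_ideal R"
  unfolding cls_def
  using ring.quotient_eq_iff_same_a_r_cos[OF ring_free_ring ideal_rel_ideal, of x y]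
  by (simp add: free_ring_minus) (simp add: free_ring_def)

lemma cls_hom: "cls R \<in> ring_hom free_ring (pres_alg R)"
  unfolding pres_alg_def
  using ideal.rcos_ring_hom[OF ideal_rel_ideal] by (simp add: cls_def[abs_def])

lemma
  shows cls_add: "cls R (x + y) = cls R x \<oplus>\<^bsub>pres_alg R\<^esub> cls R y"
    and cls_mult: "cls R (x * y) = cls R x \<otimes>\<^bsub>pres_alg R\<^esub> cls R y"
    and cls_one: "cls R 1 = \<one>\<^bsub>pres_alg R\<^esub>"
    and cls_closed: "cls R x \<in> carrier (pres_alg R)"
  using ring_hom_add[OF cls_hom, of x y R] ring_hom_mult[OF cls_hom, of x y R]
    ring_hom_one[OF cls_hom, of R] ring_hom_closed[OF cls_hom, of x R]
  by (simp_all add: free_ring_def)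

lemma cls_0: "cls R 0 = \<zero>\<^bsub>pres_alg R\<^esub>"
proof -
  interpret ring "pres_alg R" by (rule ring_pres_alg)
  show ?thesis
    using cls_add[of R 0 0] cls_closed[of R 0] by (metis add.r_cancel_one' add_0)
qed

lemma cls_uminus: "cls R (- x) = \<ominus>\<^bsub>pres_alg R\<^esub> cls R x"
proof -
  interpret ring "pres_alg R" by (rule ring_pres_alg)
  show ?thesis
    by (rule minus_equality[symmetric]) (simp_all add: cls_closed cls_add[symmetric] cls_0)
qed

lemma carrier_pres_alg: "carrier (pres_alg R) = range (cls R)"
proof -
  have "carrier free_ring = UNIV" by (simp add: free_ring_def)
  then show ?thesis by (auto simp: pres_alg_def FactRing_def A_RCOSETS_defs cls_def a_r_coset_def)
qed

text \<open>Induction on both sides. Elements of the ideal may be added to the generators because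
  their class is zero.\<close>

lemma gen_subalg_cls: "gen_subalg R (cls R ` X) = cls R ` subalg (X \<union> rel_ideal R)"
proof (intro equalityI subsetI)
  fix u assume "u \<in> gen_subalg R (cls R ` X)"
  then show "u \<in> cls R ` subalg (X \<union> rel_ideal R)"
    unfolding gen_subalg_def
  proof (induction rule: generate_ring.induct)
    case one
    show ?case using subalg.cst[of 1] cls_one by (metis cst_1 image_eqI)
  next
    case (a_inv h)
    then show ?case
      by (auto simp only: cls_uminus[symmetric] intro: csubspace_uminus[OF csubspace_subalg])
  next
    case (eng_add h1 h2)
    then show ?case by (auto simp only: cls_add[symmetric] intro: subalg.add)
  next
    case (eng_mult h1 h2)
    then show ?case by (auto simp only: cls_mult[symmetric] intro: subalg.mult)
  qed (auto intro: subalg.intros)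
next
  fix u assume "u \<in> cls R ` subalg (X \<union> rel_ideal R)"
  then obtain x where x: "x \<in> subalg (X \<union> rel_ideal R)" and u: "u = cls R x" by blast
  from x have "cls R x \<in> gen_subalg R (cls R ` X)"
    unfolding gen_subalg_def
  proof (induction rule: subalg.induct)
    case (base x)
    then show ?case
      using cls_eq_iff[of R x 0] ring.zero_in_generate[OF ring_pres_alg, of R]
      by (auto simp: cls_0 intro: generate_ring.incl)
  qed (auto simp: cls_add cls_mult intro: generate_ring.intros)
  then show "u \<in> gen_subalg R (cls R ` X)" by (simp add: u)
qed

lemma centralizer_cls:
  "centralizer (pres_alg R) (cls R t) = cls R ` {x. x * t - t * x \<in> rel_ideal R}"
  unfolding centralizer_def carrier_pres_alg cls_eq_iff[symmetric]
  by (auto simp only: cls_mult)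

text \<open>The generators and the scalars generate the source, and a homomorphism fixes the
  scalars; conversely, the image is a subring containing the images of the generators and the
  scalars.\<close>

lemma alg_hom_image:
  assumes \<phi>: "\<phi> \<in> alg_hom R S"
  shows "\<phi> ` carrier (pres_alg R) = gen_subalg S (range (\<lambda>g. \<phi> (cls R (gen g))))"
proof -
  interpret R: ring "pres_alg R" by (rule ring_pres_alg)
  interpret S: ring "pres_alg S" by (rule ring_pres_alg)
  interpret ring_hom_ring "pres_alg R" "pres_alg S" \<phi>
    using \<phi> by (intro ring_hom_ringI2 ring_pres_alg) (simp add: alg_hom_def)
  have hcst: "\<phi> (cls R (cst z)) = cls S (cst z)" for z
    using \<phi> by (simp add: alg_hom_def)
  show ?thesis
  proof (intro equalityI)
    show "\<phi> ` carrier (pres_alg R) \<subseteq> gen_subalg S (range (\<lambda>g. \<phi> (cls R (gen g))))"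
    proof
      fix u assume "u \<in> \<phi> ` carrier (pres_alg R)"
      then obtain x where u: "u = \<phi> (cls R x)" by (auto simp: carrier_pres_alg)
      have "x \<in> subalg (range gen)" by (simp add: subalg_range_gen)
      then have "\<phi> (cls R x) \<in> gen_subalg S (range (\<lambda>g. \<phi> (cls R (gen g))))"
        unfolding gen_subalg_def
      proof (induction rule: subalg.induct)
        case (cst z)
        then show ?case by (auto simp: hcst intro: generate_ring.incl)
      qed (auto simp: cls_add cls_mult cls_closed intro: generate_ring.intros)
      then show "u \<in> gen_subalg S (range (\<lambda>g. \<phi> (cls R (gen g))))" by (simp add: u)
    qed
  next
    have "subring (\<phi> ` carrier (pres_alg R)) (pres_alg S)"
      by (rule img_is_subring[OF R.carrier_is_subring])
    moreover have "range (\<lambda>z. cls S (cst z)) \<union> range (\<lambda>g. \<phi> (cls R (gen g)))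
        \<subseteq> \<phi> ` carrier (pres_alg R)"
      by (auto simp: hcst[symmetric] cls_closed)
    ultimately show "gen_subalg S (range (\<lambda>g. \<phi> (cls R (gen g)))) \<subseteq> \<phi> ` carrier (pres_alg R)"
      unfolding gen_subalg_def
      by (intro S.generate_ring_min_subring1) (auto simp: cls_closed)
  qed
qed

lemma cst_mult_left: "cst x * (cst y * p) = cst (x * y) * p"
  by (simp add: cst_mult mult.assoc)

section \<open>The centralizer of \<open>T\<^sub>1\<close>\<close>

text \<open>Replacing one of the three factors by \<open>{1}\<close> gives the left module spanned
  by \<open>G\<close> over \<open>M\<close>, the right module spanned by \<open>G\<close> over
  \<open>N\<close>, or the product of \<open>M\<close> and \<open>N\<close>.\<close>

inductive_set bspan :: "'a::ring_1 set \<Rightarrow> 'a set \<Rightarrow> 'a set \<Rightarrow> 'a set" for M G N where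
  zero: "0 \<in> bspan M G N"
| add: "x \<in> bspan M G N \<Longrightarrow> y \<in> bspan M G N \<Longrightarrow> x + y \<in> bspan M G N"
| mult: "m \<in> M \<Longrightarrow> g \<in> G \<Longrightarrow> n \<in> N \<Longrightarrow> m * g * n \<in> bspan M G N"

lemma bspan_left_closed:
  assumes "\<And>m. m \<in> M \<Longrightarrow> x * m \<in> M" and "v \<in> bspan M G N"
  shows "x * v \<in> bspan M G N"
  using assms(2)
proof (induction rule: bspan.induct)
  case (mult m g n)
  then show ?case using bspan.mult[OF assms(1), of m g G n N] by (simp add: mult.assoc)
qed (auto simp: distrib_left intro: bspan.intros)

lemma bspan_right_closed:
  assumes "\<And>n. n \<in> N \<Longrightarrow> n * x \<in> N" and "v \<in> bspan M G N"
  shows "v * x \<in> bspan M G N"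
  using assms(2)
proof (induction rule: bspan.induct)
  case (mult m g n)
  then show ?case using bspan.mult[of m M g G "n * x" N] assms(1) by (simp add: mult.assoc)
qed (auto simp: distrib_right intro: bspan.intros)

text \<open>Scalars are central, so they can be absorbed by whichever outer factor is a
  subspace.\<close>

lemma csubspace_bspan:
  assumes "csubspace M \<or> csubspace N"
  shows "csubspace (bspan M G N)"
proof (rule csubspaceI)
  fix z v assume v: "v \<in> bspan M G N"
  from assms show "cst z * v \<in> bspan M G N"
  proof
    assume "csubspace M"
    then show ?thesis by (rule bspan_left_closed[OF csubspace_scale v])
  next
    assume "csubspace N"
    then have "v * cst z \<in> bspan M G N"
      by (intro bspan_right_closed[OF _ v]) (simp add: cst_commute[of _ z] csubspace_scale)
    then show ?thesis by (simp only: cst_commute[of v])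
  qed
qed (rule bspan.zero bspan.add; assumption)+

text \<open>By linearity in \<open>v\<close> only single products matter. One of \<open>x\<close>
  and \<open>y\<close> is 1 in one-sided applications.\<close>

lemma bspan_sandwich:
  assumes "csubspace V" and "v \<in> bspan M G N"
    and "\<And>m g n. m \<in> M \<Longrightarrow> g \<in> G \<Longrightarrow> n \<in> N \<Longrightarrow> x * (m * g * n) * y \<in> V"
  shows "x * v * y \<in> V"
  using assms(2)
  by (induction rule: bspan.induct)
    (auto simp: distrib_left distrib_right assms(3)
      intro: csubspace_0[OF assms(1)] csubspace_add[OF assms(1)])

lemma cst_scale_relation:
  "cst r * (p - (cst x * v + cst y * w - cst z))
    = cst r * p - (cst (r * x) * v + cst (r * y) * w - cst (r * z))"
  by (simp add: right_diff_distrib distrib_left cst_mult_left cst_mult[of r z])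

text \<open>If \<open>t\<close> is a root of \<open>t * t + s * t + k\<close>, its two eigenvalues
  add up to \<open>- s\<close>, so \<open>t * h + h * t + s * h\<close> vanishes when
  \<open>h\<close> interchanges the eigenspaces. The identity shows that \<open>E\<close>
  annihilates such \<open>h\<close>.\<close>

lemma off_diagonal_identity:
  fixes t h s k :: "'a::ring_1"
  assumes "t * s = s * t"
  shows "2 * (t * h * t) + s * (t * h + h * t) + (s\<^sup>2 - 2 * k) * h
    = 2 * (t * (t * h + h * t + s * h)) + s * (t * h + h * t + s * h)
      - 2 * ((t * t + s * t + k) * h)"
proof -
  have "t * (s * h) = s * (t * h)"
    using assms by (metis mult.assoc)
  then show ?thesis
    by (simp add: power2_eq_square algebra_simps mult_2 mult_2_right)
qed

text \<open>The counterpart for \<open>h\<close> commuting with \<open>t\<close>: there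
  \<open>E\<close> acts as the discriminant \<open>s\<^sup>2 - 4 * k\<close>.\<close>

lemma diagonal_identity:
  fixes t h s k :: "'a::ring_1"
  shows "2 * (t * h * t) + s * (t * h + h * t) + (s\<^sup>2 - 2 * k) * h - (s\<^sup>2 - 4 * k) * h
    = 2 * ((t * t + s * t + k) * h) + 2 * (t * (h * t - t * h)) + s * (h * t - t * h)"
proof -
  have "(2 + 2) * k = 2 * k + 2 * k" by (rule distrib_right)
  then have "4 * k = 2 * k + 2 * k" by simp
  then show ?thesis by (simp add: algebra_simps mult_2 mult_2_right)
qed

section \<open>Relations of the double affine Hecke algebra\<close>

locale daha =
  fixes q a b c d :: complex
  assumes q_nonzero: "q \<noteq> 0" and q_square: "q\<^sup>2 \<noteq> 1"
    and a_nonzero: "a \<noteq> 0" and b_nonzero: "b \<noteq> 0" and c_nonzero: "c \<noteq> 0" and d_nonzero: "d \<noteq> 0"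
    and ab: "a * b \<noteq> 1"
begin

abbreviation "T \<equiv> gen HT1"
abbreviation "Y \<equiv> gen HY"
abbreviation "Yi \<equiv> gen HYi"
abbreviation "Z \<equiv> gen HZ"
abbreviation "Zi \<equiv> gen HZi"
abbreviation "K0 \<equiv> Y + (inverse q * (a*b*c*d)) *\<^sub>C Yi"
abbreviation "K1 \<equiv> Z + Zi"
abbreviation "u \<equiv> 1 + inverse q * (c*d)"
abbreviation "I \<equiv> rel_ideal (daha_rels q a b c d)"

lemmas nonzero = q_nonzero a_nonzero b_nonzero c_nonzero d_nonzero

lemmas I_subspace = csubspace_rel_ideal[of "daha_rels q a b c d"]

lemma
  shows Y_Yi: "Y * Yi - 1 \<in> I" and Yi_Y: "Yi * Y - 1 \<in> I"
    and Z_Zi: "Z * Zi - 1 \<in> I" and Zi_Z: "Zi * Z - 1 \<in> I"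
    and T_square: "T^2 - (- ((a*b + 1) *\<^sub>C T) - cst (a*b)) \<in> I"
    and T_Z: "T * Z - (Zi * T + (a*b + 1) *\<^sub>C Zi - cst (a + b)) \<in> I"
    and T_Zi: "T * Zi - (Z * T - (a*b + 1) *\<^sub>C Zi + cst (a + b)) \<in> I"
    and T_Y: "T * Y - ((inverse q * (a*b*c*d)) *\<^sub>C (Yi * T) - (a*b + 1) *\<^sub>C Y + cst (a*b * u)) \<in> I"
    and T_Yi: "T * Yi - ((q * inverse (a*b*c*d)) *\<^sub>C (Y * T)
        + (q * inverse (a*b*c*d) * (1 + a*b)) *\<^sub>C Y - cst (q * inverse (c*d) * u)) \<in> I"
    and Y_Z: "Y * Z - (q *\<^sub>C (Z * Y) + ((1 + a*b) * (c*d)) *\<^sub>C (Zi * Yi * T)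
        - ((a + b) * (c*d)) *\<^sub>C (Yi * T) - u *\<^sub>C (Zi * T)
        - ((1 - q) * (1 + a*b) * u) *\<^sub>C Zi + (c + d) *\<^sub>C T + cst ((1 - q) * (a + b) * u)) \<in> I"
    and Y_Zi: "Y * Zi - (inverse q *\<^sub>C (Zi * Y)
        - (inverse q ^ 2 * (1 + a*b) * (c*d)) *\<^sub>C (Zi * Yi * T)
        + (inverse q ^ 2 * (a + b) * (c*d)) *\<^sub>C (Yi * T) + (inverse q * u) *\<^sub>C (Zi * T)
        - (inverse q * (c + d)) *\<^sub>C T) \<in> I"
    and Yi_Z: "Yi * Z - (inverse q *\<^sub>C (Z * Yi)
        - (q * inverse (a*b) * (1 + a*b)) *\<^sub>C (Zi * Yi * T)
        + (inverse (a*b) * (a + b)) *\<^sub>C (Yi * T) + (q * inverse (a*b*c*d) * u) *\<^sub>C (Zi * T)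
        + (q * inverse (a*b*c*d) * (1 - q) * (1 + a*b) * u) *\<^sub>C Zi
        - (inverse (a*b*c*d) * (c + d)) *\<^sub>C T
        - cst (inverse (a*b*c*d) * (1 - q) * (1 + a*b) * (c + d))) \<in> I"
    and Yi_Zi: "Yi * Zi - (q *\<^sub>C (Zi * Yi) + (q * inverse (a*b) * (1 + a*b)) *\<^sub>C (Zi * Yi * T)
        - (inverse (a*b) * (a + b)) *\<^sub>C (Yi * T) - (q^2 * inverse (a*b*c*d) * u) *\<^sub>C (Zi * T)
        + (q * inverse (a*b*c*d) * (c + d)) *\<^sub>C T) \<in> I"
  by (rule rel_in_rel_ideal; simp add: daha_rels_def Let_def)+

lemma quadratic: "T * T + (a*b + 1) *\<^sub>C T + cst (a*b) \<in> I"
  using T_square by (simp add: power2_eq_square algebra_simps)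

text \<open>\<open>T_Yi\<close> is rescaled so that its sum with \<open>T_Y\<close> leaves only the
  commutator of \<open>T\<close> with \<open>K0\<close>.\<close>

lemma T_Yi': "(inverse q * (a*b*c*d)) *\<^sub>C (T * Yi) - (Y * T + (a*b + 1) *\<^sub>C Y - cst (a*b * u)) \<in> I"
proof -
  let ?r = "inverse q * (a*b*c*d)"
  have 1: "?r * (q * inverse (a*b*c*d)) = 1" "?r * (q * inverse (a*b*c*d) * (1 + a*b)) = a*b + 1"
    "?r * (q * inverse (c*d) * u) = a*b*u"
    using nonzero by (simp_all add: divide_simps)
  show ?thesis
    using csubspace_scale[OF I_subspace T_Yi, of ?r]
    unfolding cst_scale_relation 1 by simp
qed

text \<open>Obtained by eliminating \<open>Yi\<close> through \<open>K0\<close>; the left part has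
  the shape that \<open>S_criterion\<close> asks for.\<close>

lemma T_Y': "T * Y + Y * T + (a*b + 1) *\<^sub>C Y - (K0 * T + cst (a*b * u)) \<in> I"
  using T_Y by (simp add: algebra_simps)

lemma T_Z': "T * Z + Z * T + (a*b + 1) *\<^sub>C Z - (K1 * T + (a*b + 1) *\<^sub>C K1 - cst (a + b)) \<in> I"
  using T_Z by (simp add: algebra_simps)

section \<open>The preimage \<open>A\<close> of the subalgebra generated by \<open>K0\<close>,
  \<open>K1\<close> and \<open>T\<close>\<close>

definition "A = subalg ({K0, K1, T} \<union> I)"

lemma A_subspace: "csubspace A"
  by (simp add: A_def csubspace_subalg)

lemma
  shows A_cst: "cst z \<in> A" and A_K0: "K0 \<in> A" and A_K1: "K1 \<in> A" and A_T: "T \<in> A"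
    and A_I: "x \<in> I \<Longrightarrow> x \<in> A"
    and A_mult: "x \<in> A \<Longrightarrow> y \<in> A \<Longrightarrow> x * y \<in> A"
  by (auto simp: A_def intro: subalg.intros)

lemma A_1: "1 \<in> A" using A_cst[of 1] by simp

lemmas A_intros = csubspace_intros[OF A_subspace] A_cst A_K0 A_K1 A_T A_1 A_mult

lemma K0_T: "K0 * T - T * K0 \<in> I"
  using csubspace_uminus[OF I_subspace csubspace_add[OF I_subspace T_Y T_Yi']]
  by (simp add: algebra_simps cst_left_commute[of T])

lemma K1_T: "K1 * T - T * K1 \<in> I"
  using csubspace_uminus[OF I_subspace csubspace_add[OF I_subspace T_Z T_Zi]]
  by (simp add: algebra_simps)

text \<open>The commutator with \<open>T\<close> is a derivation and maps the generators into the
  two-sided ideal \<open>I\<close>.\<close>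

lemma A_commute:
  assumes "x \<in> A"
  shows "x * T - T * x \<in> I"
  using assms unfolding A_def
proof (induction rule: subalg.induct)
  case (cst z)
  then show ?case using csubspace_0[OF I_subspace] by (simp add: cst_commute)
next
  case (base x)
  then show ?case
    using K0_T K1_T csubspace_0[OF I_subspace]
    by (auto intro: csubspace_diff[OF I_subspace] rel_ideal_mult_left rel_ideal_mult_right)
next
  case (add x y)
  then show ?case using csubspace_add[OF I_subspace add.IH] by (simp add: algebra_simps)
next
  case (mult x y)
  have "x * y * T - T * (x * y) = x * (y * T - T * y) + (x * T - T * x) * y"
    by (simp add: algebra_simps)
  then show ?case
    using csubspace_add[OF I_subspace
        rel_ideal_mult_left[OF mult.IH(2), of x] rel_ideal_mult_right[OF mult.IH(1), of y]] by simp
qed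

section \<open>The projection \<open>E\<close> and the bimodule \<open>S\<close>\<close>

definition "E h = 2 *\<^sub>C (T * h * T) + (a*b + 1) *\<^sub>C (T * h + h * T)
  + ((a*b + 1)^2 - 2 * (a*b)) *\<^sub>C h"

definition "S = {h. E h \<in> A}"

lemma E_add: "E (x + y) = E x + E y"
  by (simp add: E_def algebra_simps)

lemma E_scale: "E (z *\<^sub>C x) = z *\<^sub>C E x"
  by (simp add: E_def algebra_simps cst_mult_left cst_left_commute[of T])

lemma S_subspace: "csubspace S"
  using csubspace_0[OF A_subspace]
  by (intro csubspaceI)
    (auto simp: S_def E_add E_scale intro: csubspace_add[OF A_subspace] csubspace_scale[OF A_subspace],
     simp add: E_def)

text \<open>Elements of \<open>A\<close> commute with \<open>T\<close> modulo \<open>I\<close>, so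
  \<open>E\<close> is left \<open>A\<close>-linear up to an error in \<open>I\<close>, which is part
  of \<open>A\<close>.\<close>

lemma S_mult_left:
  assumes "x \<in> A" "h \<in> S"
  shows "x * h \<in> S"
proof -
  have "E (x * h) = x * E h
      - (2 *\<^sub>C ((x * T - T * x) * (h * T)) + (a*b + 1) *\<^sub>C ((x * T - T * x) * h))"
    by (simp add: E_def algebra_simps cst_left_commute[of x])
  also have "\<dots> \<in> A"
    using assms by (intro A_intros A_I[OF rel_ideal_mult_right[OF A_commute]]) (simp_all add: S_def)
  finally show ?thesis by (simp add: S_def)
qed

lemma S_mult_right:
  assumes "h \<in> S" "x \<in> A"
  shows "h * x \<in> S"
proof -
  have "E (h * x) = E h * x
      + (2 *\<^sub>C ((T * h) * (x * T - T * x)) + (a*b + 1) *\<^sub>C (h * (x * T - T * x)))"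
    by (simp add: E_def algebra_simps)
  also have "\<dots> \<in> A"
    using assms by (intro A_intros A_I[OF rel_ideal_mult_left[OF A_commute]]) (simp_all add: S_def)
  finally show ?thesis by (simp add: S_def)
qed

text \<open>By \<open>off_diagonal_identity\<close>, \<open>E h\<close> is a left combination of the
  given element over \<open>A\<close>, up to a multiple of the quadratic relation.\<close>

lemma S_criterion:
  assumes "T * h + h * T + (a*b + 1) *\<^sub>C h \<in> A"
  shows "h \<in> S"
proof -
  define n where "n = T * h + h * T + (a*b + 1) *\<^sub>C h"
  have "E h = 2 *\<^sub>C (T * n) + (a*b + 1) *\<^sub>C n
      - 2 *\<^sub>C ((T * T + (a*b + 1) *\<^sub>C T + cst (a*b)) * h)"
    using off_diagonal_identity[OF cst_commute[of T "a*b + 1"], of h "cst (a*b)"]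
    by (simp only: E_def n_def cst_diff cst_power cst_mult[of 2] cst_numeral)
  moreover have "n \<in> A" using assms by (simp add: n_def)
  ultimately have "E h \<in> A"
    by (auto intro!: A_intros A_I[OF rel_ideal_mult_right[OF quadratic]] simp del: cst_numeral)
  then show ?thesis by (simp add: S_def)
qed

lemma Y_in_S: "Y \<in> S"
proof (rule S_criterion)
  show "T * Y + Y * T + (a*b + 1) *\<^sub>C Y \<in> A"
    unfolding csubspace_diff_iff[OF A_subspace A_I[OF T_Y']] by (intro A_intros)
qed

lemma Z_in_S: "Z \<in> S"
proof (rule S_criterion)
  show "T * Z + Z * T + (a*b + 1) *\<^sub>C Z \<in> A"
    unfolding csubspace_diff_iff[OF A_subspace A_I[OF T_Z']] by (intro A_intros)
qed

lemma one_in_S: "1 \<in> S"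
proof -
  have "E 1 \<in> A" unfolding E_def by (intro A_intros)
  then show ?thesis by (simp add: S_def)
qed

lemma A_in_S: "x \<in> A \<Longrightarrow> x \<in> S"
  using S_mult_left[OF _ one_in_S] by simp

lemma I_in_S: "x \<in> I \<Longrightarrow> x \<in> S"
  by (intro A_in_S A_I)

lemmas S_intros = csubspace_intros[OF S_subspace] S_mult_left S_mult_right

lemma S_cancel:
  assumes "x + y \<in> S" "y \<in> S"
  shows "x \<in> S"
  using csubspace_diff[OF S_subspace assms] by simp

lemma ZY_in_S: "Z * Y \<in> S"
proof -
  let ?p = "inverse q * (a*b*c*d)"
  define W X where "W = Z * Y" and "X = Zi * Yi * T"
  have in_S: "cst z \<in> S" "T \<in> S" "Zi \<in> S" "Zi * T \<in> S" "Yi * T \<in> S" for z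
  proof -
    show "cst z \<in> S" "T \<in> S" by (intro A_in_S A_intros)+
    show *: "Zi \<in> S"
      using csubspace_diff[OF S_subspace A_in_S[OF A_K1] Z_in_S] by simp
    then show "Zi * T \<in> S" by (intro S_intros A_intros)
    have "?p *\<^sub>C Yi \<in> S"
      using csubspace_diff[OF S_subspace A_in_S[OF A_K0] Y_in_S] by simp
    then have "Yi \<in> S"
      using nonzero by (subst (asm) csubspace_scale_iff[OF S_subspace]) auto
    then show "Yi * T \<in> S" by (intro S_intros A_intros)
  qed
  \<comment> \<open>Substituting \<open>K1 - Z\<close> for \<open>Zi\<close> and
    \<open>K0 - Y\<close> for the multiple of \<open>Yi\<close> leaves \<open>Z * Y * T\<close> as
    the only term not yet known to be in \<open>S\<close>.\<close>
  have X: "?p *\<^sub>C X - W * T \<in> S"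
  proof -
    have "?p *\<^sub>C X - W * T = K1 * K0 * T - Z * (K0 * T) - K1 * Y * T"
      by (simp add: X_def W_def algebra_simps cst_left_commute)
    also have "\<dots> \<in> S"
      by (intro csubspace_diff[OF S_subspace] S_mult_left S_mult_right Z_in_S Y_in_S A_in_S A_mult
          A_K0 A_K1 A_T)
    finally show ?thesis .
  qed
  \<comment> \<open>The two reordering relations follow, stripped of the terms already known to lie
    in \<open>S\<close>.\<close>
  have 1: "Y * Z - q *\<^sub>C W - ((1 + a*b) * (c*d)) *\<^sub>C X \<in> S" (is "?L \<in> S")
  proof -
    let ?R = "- (((a + b) * (c*d)) *\<^sub>C (Yi * T)) - u *\<^sub>C (Zi * T)
        - ((1 - q) * (1 + a*b) * u) *\<^sub>C Zi + (c + d) *\<^sub>C T + cst ((1 - q) * (a + b) * u)"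
    have "?L - ?R \<in> S"
      using I_in_S[OF Y_Z]
      by (simp only: W_def X_def diff_conv_add_uminus minus_add_distrib minus_minus add_ac)
    moreover have "?R \<in> S"
      by (intro csubspace_intros[OF S_subspace] in_S)
    ultimately show ?thesis using csubspace_diff_iff[OF S_subspace] by blast
  qed
  have 2: "Y * Zi - inverse q *\<^sub>C (Zi * Y)
      + (inverse q ^ 2 * (1 + a*b) * (c*d)) *\<^sub>C X \<in> S" (is "?L \<in> S")
  proof -
    let ?R = "(inverse q ^ 2 * (a + b) * (c*d)) *\<^sub>C (Yi * T) + (inverse q * u) *\<^sub>C (Zi * T)
        - (inverse q * (c + d)) *\<^sub>C T"
    have "?L - ?R \<in> S"
      using I_in_S[OF Y_Zi]
      by (simp only: X_def diff_conv_add_uminus minus_add_distrib minus_minus add_ac)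
    moreover have "?R \<in> S"
      by (intro csubspace_intros[OF S_subspace] in_S)
    ultimately show ?thesis using csubspace_diff_iff[OF S_subspace] by blast
  qed
  let ?f = "inverse q ^ 2 - 1" and ?k = "(1 + a*b) * (c*d)"
  \<comment> \<open>Chosen so that the sum with \<open>1\<close> and \<open>2\<close> cancels
    \<open>Y * Z\<close>, \<open>Y * Zi\<close> and \<open>Zi * Y\<close>, leaving only
    \<open>W\<close> and \<open>X\<close>.\<close>
  have "inverse q *\<^sub>C (K1 * Y) - Y * K1 \<in> S"
    by (intro csubspace_intros[OF S_subspace] S_mult_left S_mult_right Y_in_S A_K1)
  from csubspace_add[OF S_subspace csubspace_add[OF S_subspace 1 2] this]
  have "(inverse q - q) *\<^sub>C W + (?f * ?k) *\<^sub>C X \<in> S"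
    by (simp add: W_def cst_diff algebra_simps)
  \<comment> \<open>This eliminates \<open>X\<close> in favour of \<open>W * T\<close>.\<close>
  from csubspace_diff[OF S_subspace csubspace_scale[OF S_subspace this, of ?p]
      csubspace_scale[OF S_subspace X, of "?f * ?k"]]
  have "(?p * (inverse q - q)) *\<^sub>C W + (?f * ?k) *\<^sub>C (W * T) \<in> S"
    by (simp add: distrib_left right_diff_distrib cst_mult_left mult.commute[of ?p])
  also have "(?p * (inverse q - q)) *\<^sub>C W + (?f * ?k) *\<^sub>C (W * T)
      = (?f * (c*d)) *\<^sub>C ((a*b) *\<^sub>C W + (a*b + 1) *\<^sub>C (W * T))"
  proof -
    have "?p * (inverse q - q) = ?f * (c*d) * (a*b)"
      using q_nonzero by (simp add: field_simps power2_eq_square)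
    moreover have "?f * ?k = ?f * (c*d) * (a*b + 1)" by (simp add: algebra_simps)
    ultimately show ?thesis by (simp only: distrib_left cst_mult_left)
  qed
  \<comment> \<open>The common factor \<open>?f * (c*d)\<close> is nonzero because
    \<open>q\<^sup>2 \<noteq> 1\<close> and \<open>c\<close>, \<open>d\<close> are nonzero.\<close>
  finally have W: "(a*b) *\<^sub>C W + (a*b + 1) *\<^sub>C (W * T) \<in> S"
    using nonzero q_square
    by (subst (asm) csubspace_scale_iff[OF S_subspace]) (auto simp: field_simps)
  have Q: "V * T * T + ((a*b) *\<^sub>C V + (a*b + 1) *\<^sub>C (V * T)) \<in> S" for V
    using I_in_S[OF rel_ideal_mult_left[OF quadratic, of V]]
    by (simp add: distrib_left cst_left_commute cst_commute mult.assoc add_ac)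
  have WTT: "W * T * T \<in> S"
    by (rule S_cancel[OF Q W])
  \<comment> \<open>Since \<open>a*b\<close> is nonzero, the quadratic relation lets
    \<open>T\<close> be divided out on the right: first from \<open>W * T * T\<close>, then from
    \<open>W * T\<close>.\<close>
  have "(a*b) *\<^sub>C (W * T) \<in> S"
  proof (rule S_cancel)
    show "(a*b) *\<^sub>C (W * T) + (W * T * T * T + (a*b + 1) *\<^sub>C (W * T * T)) \<in> S"
      using Q[of "W * T"] by (simp only: add_ac)
    show "W * T * T * T + (a*b + 1) *\<^sub>C (W * T * T) \<in> S"
      by (intro csubspace_intros[OF S_subspace] S_mult_right[OF _ A_T] WTT)
  qed
  then have "W * T \<in> S"
    using nonzero by (subst (asm) csubspace_scale_iff[OF S_subspace]) auto
  from S_cancel[OF W csubspace_scale[OF S_subspace this]] have "W \<in> S"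
    using nonzero by (subst (asm) csubspace_scale_iff[OF S_subspace]) auto
  then show ?thesis by (simp add: W_def)
qed

section \<open>Factorization into a \<open>Z\<close>-part \<open>L\<close> and a
  \<open>Y\<close>-part \<open>R\<close>\<close>

definition "L = subalg ({Z, Zi, T} \<union> I)"

definition "R = subalg ({Y, Yi, T} \<union> I)"

lemma L_subspace: "csubspace L"
  by (simp add: L_def csubspace_subalg)

lemma
  shows L_cst: "cst z \<in> L" and L_Z: "Z \<in> L" and L_Zi: "Zi \<in> L" and L_T: "T \<in> L"
    and L_I: "x \<in> I \<Longrightarrow> x \<in> L" and L_mult: "x \<in> L \<Longrightarrow> y \<in> L \<Longrightarrow> x * y \<in> L"
  by (auto simp: L_def intro: subalg.intros)

lemmas L_intros = csubspace_intros[OF L_subspace] L_cst L_Z L_Zi L_T L_I L_mult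

lemma
  shows R_cst: "cst z \<in> R" and R_Y: "Y \<in> R" and R_Yi: "Yi \<in> R"
    and R_mult: "x \<in> R \<Longrightarrow> y \<in> R \<Longrightarrow> x * y \<in> R"
  by (auto simp: R_def intro: subalg.intros)

text \<open>The left \<open>A\<close>-module spanned by 1 and \<open>Z\<close> contains 1 and is
  stable under right multiplication by the generators of \<open>L\<close>: \<open>Zi\<close> is
  \<open>K1 - Z\<close>, the square of \<open>Z\<close> is \<open>K1 * Z - 1\<close> modulo
  \<open>I\<close>, and \<open>T_Z'\<close> rewrites \<open>Z * T\<close>.\<close>

lemma L_decomp: "L \<subseteq> bspan A {1, Z} {1}" (is "_ \<subseteq> ?V")
proof
  fix x assume "x \<in> L"
  have V: "csubspace ?V" by (simp add: csubspace_bspan A_subspace)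
  have Vmult: "y * v \<in> ?V" if "y \<in> A" "v \<in> ?V" for y v
    using that by (intro bspan_left_closed A_mult)
  have VA: "y \<in> ?V" if "y \<in> A" for y
    using bspan.mult[OF that, of 1 "{1, Z}" 1 "{1}"] by simp
  have VZ: "Z \<in> ?V"
    using bspan.mult[OF A_1, of Z "{1, Z}" 1 "{1}"] by simp
  have VZi: "Zi \<in> ?V"
    using csubspace_diff[OF V VA[OF A_K1] VZ] by simp
  have Z_Zi_V: "Z * Zi \<in> ?V"
    using VA[OF A_1] csubspace_diff_iff[OF V VA[OF A_I[OF Z_Zi]]] by blast
  have ZZ: "Z * Z \<in> ?V"
  proof -
    have "K1 * Z - 1 - (Zi * Z - 1) \<in> ?V"
      by (intro csubspace_diff[OF V] Vmult VZ VA A_K1 A_1 A_I[OF Zi_Z])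
    then show ?thesis by (simp add: algebra_simps)
  qed
  have ZT: "Z * T \<in> ?V"
  proof -
    have "K1 * T + (a*b + 1) *\<^sub>C K1 - cst (a + b) \<in> ?V"
      by (intro VA A_intros)
    then have *: "T * Z + Z * T + (a*b + 1) *\<^sub>C Z \<in> ?V"
      using csubspace_diff_iff[OF V VA[OF A_I[OF T_Z']]] by blast
    have "T * Z + Z * T + (a*b + 1) *\<^sub>C Z - T * Z - (a*b + 1) *\<^sub>C Z \<in> ?V"
      by (intro csubspace_diff[OF V] csubspace_scale[OF V] * Vmult VZ A_T)
    then show ?thesis by simp
  qed
  have step: "v * g \<in> ?V" if "v \<in> ?V" "g \<in> {Z, Zi, T} \<union> I" for v g
  proof -
    have g: "g \<in> ?V" "Z * g \<in> ?V"
      using that(2) VZ VZi ZZ Z_Zi_V ZT VA[OF A_T] by (auto intro: VA A_I rel_ideal_mult_left)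
    have "1 * v * g \<in> ?V"
      by (rule bspan_sandwich[OF V that(1)]) (use g in \<open>auto simp: mult.assoc intro: Vmult\<close>)
    then show ?thesis by simp
  qed
  have "1 * x \<in> ?V"
    using \<open>x \<in> L\<close> by (intro subalg_right_closed[OF V step _ VA[OF A_1]]) (simp_all add: L_def)
  then show "x \<in> ?V" by simp
qed

text \<open>The mirror image of \<open>L_decomp\<close>: a right \<open>A\<close>-module stable
  under left multiplication, with \<open>T_Y'\<close> rewriting \<open>T * Y\<close>.\<close>

lemma R_decomp: "R \<subseteq> bspan {1} {1, Y} A" (is "_ \<subseteq> ?V")
proof
  fix x assume "x \<in> R"
  have V: "csubspace ?V" by (simp add: csubspace_bspan A_subspace)
  have Vmult: "v * y \<in> ?V" if "v \<in> ?V" "y \<in> A" for y v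
    using that by (intro bspan_right_closed A_mult)
  have VA: "y \<in> ?V" if "y \<in> A" for y
    using bspan.mult[of 1 "{1}" 1 "{1, Y}", OF _ _ that] by simp
  have VY: "Y \<in> ?V"
    using bspan.mult[of 1 "{1}" Y "{1, Y}", OF _ _ A_1] by simp
  let ?p = "inverse q * (a*b*c*d)"
  have p: "?p \<noteq> 0" using nonzero by simp
  have VYi: "Yi \<in> ?V"
    using csubspace_diff[OF V VA[OF A_K0] VY] by (simp add: csubspace_scale_iff[OF V p])
  have Yi_Y_V: "Yi * Y \<in> ?V"
    using VA[OF A_1] csubspace_diff_iff[OF V VA[OF A_I[OF Yi_Y]]] by blast
  have YY: "Y * Y \<in> ?V"
  proof -
    have "Y * K0 - ?p *\<^sub>C (1 + (Y * Yi - 1)) \<in> ?V"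
      by (intro csubspace_diff[OF V] csubspace_scale[OF V] csubspace_add[OF V] Vmult VY VA
          A_K0 A_1 A_I[OF Y_Yi])
    then show ?thesis by (simp add: distrib_left cst_left_commute)
  qed
  have TY: "T * Y \<in> ?V"
  proof -
    have "K0 * T + cst (a*b * u) \<in> ?V"
      by (intro VA A_intros)
    then have *: "T * Y + Y * T + (a*b + 1) *\<^sub>C Y \<in> ?V"
      using csubspace_diff_iff[OF V VA[OF A_I[OF T_Y']]] by blast
    have "T * Y + Y * T + (a*b + 1) *\<^sub>C Y - Y * T - (a*b + 1) *\<^sub>C Y \<in> ?V"
      by (intro csubspace_diff[OF V] csubspace_scale[OF V] * Vmult VY A_T)
    then show ?thesis by simp
  qed
  have step: "g * v \<in> ?V" if "v \<in> ?V" "g \<in> {Y, Yi, T} \<union> I" for v g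
  proof -
    have g: "g \<in> ?V" "g * Y \<in> ?V"
      using that(2) VY VYi YY Yi_Y_V TY VA[OF A_T] by (auto intro: VA A_I rel_ideal_mult_right)
    have "g * v * 1 \<in> ?V"
      by (rule bspan_sandwich[OF V that(1)])
        (use g in \<open>auto simp: mult.assoc[symmetric] intro: Vmult\<close>)
    then show ?thesis by simp
  qed
  have "x * 1 \<in> ?V"
    using \<open>x \<in> R\<close> by (intro subalg_left_closed[OF V step _ VA[OF A_1]]) (simp_all add: R_def)
  then show "x \<in> ?V" by simp
qed

text \<open>Moves one \<open>Y\<close> or \<open>Yi\<close> to the right past all of
  \<open>L\<close>. The left \<open>L\<close>-module spanned by 1, \<open>Y\<close> and
  \<open>Yi\<close> is stable under right multiplication by the generators of
  \<open>L\<close>.\<close>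

lemma Y_L:
  assumes "y \<in> {Y, Yi}" "x \<in> L"
  shows "y * x \<in> bspan L {1, Y, Yi} {1}" (is "_ \<in> ?V")
proof -
  have V: "csubspace ?V" by (simp add: csubspace_bspan L_subspace)
  have Vmult: "y * v \<in> ?V" if "y \<in> L" "v \<in> ?V" for y v
    using that by (intro bspan_left_closed L_mult)
  have L1: "1 \<in> L" using L_cst[of 1] by simp
  have VL: "y \<in> ?V" if "y \<in> L" for y
    using bspan.mult[OF that, of 1 "{1, Y, Yi}" 1 "{1}"] by simp
  have VY: "Y \<in> ?V" "Yi \<in> ?V"
    using bspan.mult[OF L1, of Y "{1, Y, Yi}" 1 "{1}"]
      bspan.mult[OF L1, of Yi "{1, Y, Yi}" 1 "{1}"] by simp_all
  note VI = VL[OF L_I]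
  let ?p = "inverse q * (a*b*c*d)"
  have p: "?p \<noteq> 0" using nonzero by simp
  \<comment> \<open>The relations for \<open>T\<close> are read backwards: the one for
    \<open>T * Yi\<close> yields \<open>Y * T\<close>, and below the one for \<open>T * Y\<close>
    yields \<open>Yi * T\<close>.\<close>
  have YT: "Y * T \<in> ?V"
  proof -
    have "?p *\<^sub>C (T * Yi) - (Y * T + (a*b + 1) *\<^sub>C Y - cst (a*b * u)) \<in> ?V"
      by (rule VI[OF T_Yi'])
    moreover have "?p *\<^sub>C (T * Yi) \<in> ?V"
      by (intro csubspace_scale[OF V] Vmult L_T VY)
    ultimately have *: "Y * T + (a*b + 1) *\<^sub>C Y - cst (a*b * u) \<in> ?V"
      using csubspace_diff_iff[OF V] by blast
    have "Y * T + (a*b + 1) *\<^sub>C Y - cst (a*b * u) - (a*b + 1) *\<^sub>C Y + cst (a*b * u) \<in> ?V"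
      by (intro csubspace_diff[OF V] csubspace_add[OF V] csubspace_scale[OF V] * VY VL L_cst)
    then show ?thesis by simp
  qed
  have YiT: "Yi * T \<in> ?V"
  proof -
    have "T * Y \<in> ?V" by (intro Vmult L_T VY)
    then have *: "?p *\<^sub>C (Yi * T) - (a*b + 1) *\<^sub>C Y + cst (a*b * u) \<in> ?V"
      using csubspace_diff_iff[OF V VI[OF T_Y]] by blast
    have "?p *\<^sub>C (Yi * T) - (a*b + 1) *\<^sub>C Y + cst (a*b * u) + (a*b + 1) *\<^sub>C Y
        - cst (a*b * u) \<in> ?V"
      by (intro csubspace_diff[OF V] csubspace_add[OF V] csubspace_scale[OF V] * VY VL L_cst)
    then show ?thesis by (simp add: csubspace_scale_iff[OF V p])
  qed
  have ZiYiT: "Zi * Yi * T \<in> ?V"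
    using Vmult[OF L_Zi YiT] by (simp add: mult.assoc)
  have YZ: "Y * Z \<in> ?V" "Y * Zi \<in> ?V" "Yi * Z \<in> ?V" "Yi * Zi \<in> ?V"
    unfolding csubspace_diff_iff[OF V VI[OF Y_Z]] csubspace_diff_iff[OF V VI[OF Y_Zi]]
      csubspace_diff_iff[OF V VI[OF Yi_Z]] csubspace_diff_iff[OF V VI[OF Yi_Zi]]
    by (intro csubspace_intros[OF V] ZiYiT YiT VL[OF L_cst] VL[OF L_T] VL[OF L_Zi]
        VL[OF L_mult[OF L_Zi L_T]] Vmult[OF L_Z] Vmult[OF L_Zi] VY)+
  have step: "v * g \<in> ?V" if "v \<in> ?V" "g \<in> {Z, Zi, T} \<union> I" for v g
  proof -
    have g: "g \<in> ?V" "Y * g \<in> ?V" "Yi * g \<in> ?V"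
      using that(2) YZ YT YiT by (auto intro: VL L_Z L_Zi L_T VI rel_ideal_mult_left)
    have "1 * v * g \<in> ?V"
      by (rule bspan_sandwich[OF V that(1)]) (use g in \<open>auto simp: mult.assoc intro: Vmult\<close>)
    then show ?thesis by simp
  qed
  show ?thesis
    using assms VY by (intro subalg_right_closed[OF V step]) (auto simp only: L_def)
qed

text \<open>The span contains 1 and is stable under left multiplication by every generator, hence is
  everything.\<close>

lemma L_R_spans: "bspan L {1} R = UNIV" (is "?V = _")
proof -
  have V: "csubspace ?V" by (simp add: csubspace_bspan L_subspace)
  have step: "g * v \<in> ?V" if "v \<in> ?V" "g \<in> range gen" for g v
  proof -
    from that(2) obtain k where "g = gen k" by blast
    then consider "g \<in> {Z, Zi, T}" | "g \<in> {Y, Yi}"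
      by (cases k) auto
    then show ?thesis
    proof cases
      case 1
      then have "g \<in> L" by (auto intro: L_intros)
      then show ?thesis using that(1) by (intro bspan_left_closed L_mult)
    next
      case 2
      have "g * v * 1 \<in> ?V"
      proof (rule bspan_sandwich[OF V that(1)])
        fix l h r assume lhr: "l \<in> L" "h \<in> {1 :: daha_gen free_alg}" "r \<in> R"
        \<comment> \<open>\<open>Y_L\<close> moves \<open>g\<close> past \<open>l\<close>; the
          resulting 1, \<open>Y\<close> or \<open>Yi\<close> is absorbed into
          \<open>r\<close>.\<close>
        have "1 * (g * l) * r \<in> ?V"
        proof (rule bspan_sandwich[OF V Y_L[OF 2 \<open>l \<in> L\<close>]])
          fix m k n assume "m \<in> L" "k \<in> {1, Y, Yi}" "n \<in> {1 :: daha_gen free_alg}"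
          moreover from this have "k * r \<in> R"
            using \<open>r \<in> R\<close> R_mult R_Y R_Yi by auto
          ultimately show "1 * (m * k * n) * r \<in> ?V"
            using bspan.mult[of m L 1 "{1}" "k * r" R] by (auto simp: mult.assoc)
        qed
        then show "g * (l * h * r) * 1 \<in> ?V" using lhr by (simp add: mult.assoc)
      qed
      then show ?thesis by simp
    qed
  qed
  have 1: "1 \<in> ?V"
    using bspan.mult[of 1 L 1 "{1}" 1 R] L_cst[of 1] R_cst[of 1] by simp
  have "x * 1 \<in> ?V" if "x \<in> subalg (range gen)" for x
    using that by (intro subalg_left_closed[OF V step _ 1])
  then show ?thesis by (auto simp: subalg_range_gen)
qed

section \<open>Identification of \<open>A\<close> with the elements commuting with \<open>T\<close>
  modulo \<open>I\<close>\<close>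

lemma S_eq_UNIV: "S = UNIV"
proof -
  have "l * r \<in> S" if "l \<in> L" "r \<in> R" for l r
  proof -
    have "1 * l * r \<in> S"
    proof (rule bspan_sandwich[OF S_subspace])
      show "l \<in> bspan A {1, Z} {1}" using that L_decomp by blast
      fix m g n assume m: "m \<in> A" "g \<in> {1, Z}" "n \<in> {1 :: daha_gen free_alg}"
      have "m * g * r * 1 \<in> S"
      proof (rule bspan_sandwich[OF S_subspace])
        show "r \<in> bspan {1} {1, Y} A" using that R_decomp by blast
        fix m' g' n' assume m': "m' \<in> {1 :: daha_gen free_alg}" "g' \<in> {1, Y}" "n' \<in> A"
        \<comment> \<open>Only the four products 1, \<open>Y\<close>, \<open>Z\<close> and
          \<open>Z * Y\<close> remain; \<open>A\<close> acts on both outer sides.\<close>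
        have "g * g' \<in> S"
          using m m' one_in_S Y_in_S Z_in_S ZY_in_S by auto
        then have "m * (g * g') * n' \<in> S"
          using m m' by (intro S_mult_right[OF S_mult_left])
        then show "m * g * (m' * g' * n') * 1 \<in> S"
          using m' by (simp add: mult.assoc)
      qed
      then show "1 * (m * g * n) * r \<in> S" using m by simp
    qed
    then show ?thesis by simp
  qed
  then have "1 * x * 1 \<in> S" for x
    using bspan_sandwich[OF S_subspace, of x L "{1}" R 1 1] by (simp add: L_R_spans)
  then show ?thesis by auto
qed

lemma A_eq: "A = {h. h * T - T * h \<in> I}"
proof (intro equalityI subsetI CollectI A_commute)
  fix h assume "h \<in> {h. h * T - T * h \<in> I}"
  then have h: "h * T - T * h \<in> I" by simp
  let ?D = "h * T - T * h"
  \<comment> \<open>The discriminant of the quadratic relation, that is, the squared difference of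
    its roots \<open>- 1\<close> and \<open>- (a*b)\<close>.\<close>
  have e: "(1 - a*b)^2 = (a*b + 1)^2 - 4 * (a*b)"
    by (simp add: power2_eq_square algebra_simps)
  have "E h \<in> A" using S_eq_UNIV by (auto simp: S_def)
  moreover have "E h - ((1 - a*b)^2) *\<^sub>C h \<in> A"
  proof -
    have "E h - ((1 - a*b)^2) *\<^sub>C h
        = 2 *\<^sub>C ((T * T + (a*b + 1) *\<^sub>C T + cst (a*b)) * h) + 2 *\<^sub>C (T * ?D) + (a*b + 1) *\<^sub>C ?D"
      using diagonal_identity[of T h "cst (a*b + 1)" "cst (a*b)"]
      by (simp only: E_def e cst_diff cst_power cst_mult[of 2] cst_mult[of 4] cst_numeral)
    also have "\<dots> \<in> A"
      using h quadratic by (intro csubspace_add[OF A_subspace] csubspace_scale[OF A_subspace] A_I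
          rel_ideal_mult_left rel_ideal_mult_right)
    finally show ?thesis .
  qed
  ultimately have "((1 - a*b)^2) *\<^sub>C h \<in> A"
    using csubspace_diff_iff[OF A_subspace] by blast
  \<comment> \<open>Here \<open>a * b \<noteq> 1\<close> makes the scalar invertible.\<close>
  then show "h \<in> A"
    using ab by (simp add: csubspace_scale_iff[OF A_subspace])
qed

end

theorem theorem5p1:
  fixes q a b c d :: complex
  assumes "q \<noteq> 0" and "\<forall>m::nat. m \<ge> 1 \<longrightarrow> q ^ m \<noteq> 1"
    and "a \<noteq> 0" and "b \<noteq> 0" and "c \<noteq> 0" and "d \<noteq> 0"
    and "\<forall>m::nat. a * b * c * d \<noteq> inverse (q ^ m)"
    and "a * b \<noteq> 1"
  shows "centralizer (DAHA q a b c d) (daha_T1 q a b c d)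
           = gen_subalg (daha_rels q a b c d)
               {daha_K0 q a b c d, daha_K1 q a b c d, daha_T1 q a b c d}
       \<and> (\<forall>\<phi>. AW_embedding q a b c d \<phi> \<longrightarrow>
            centralizer (DAHA q a b c d) (daha_T1 q a b c d) = \<phi> ` carrier (AW q a b c d))"
proof -
  \<comment> \<open>The exponent 2 in the second assumption gives \<open>q_square\<close>.\<close>
  interpret daha q a b c d
    using assms(1,3-6,8) assms(2)[rule_format, of 2] by unfold_locales simp_all
  let ?R = "daha_rels q a b c d" and ?\<rho> = "aw_rels q a b c d"
  have gens: "{daha_K0 q a b c d, daha_K1 q a b c d, daha_T1 q a b c d} = cls ?R ` {K0, K1, T}"
    by (simp add: daha_T1_def daha_K0_def daha_K1_def)
  have "centralizer (DAHA q a b c d) (daha_T1 q a b c d) = cls ?R ` A"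
    by (simp only: DAHA_def daha_T1_def centralizer_cls A_eq)
  also have "\<dots> = gen_subalg ?R {daha_K0 q a b c d, daha_K1 q a b c d, daha_T1 q a b c d}"
    by (simp only: gens gen_subalg_cls A_def)
  finally have *: "centralizer (DAHA q a b c d) (daha_T1 q a b c d)
    = gen_subalg ?R {daha_K0 q a b c d, daha_K1 q a b c d, daha_T1 q a b c d}" .
  \<comment> \<open>Any embedding has the prescribed values on the three generators, so
    \<open>alg_hom_image\<close> determines its image.\<close>
  moreover have "\<phi> ` carrier (AW q a b c d)
      = gen_subalg ?R {daha_K0 q a b c d, daha_K1 q a b c d, daha_T1 q a b c d}"
    if \<phi>: "AW_embedding q a b c d \<phi>" for \<phi>
  proof -
    have UNIV: "UNIV = {AK0, AK1, AT1}"
      using aw_gen.exhaust by auto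
    have "range (\<lambda>g. \<phi> (cls ?\<rho> (gen g)))
        = {daha_K0 q a b c d, daha_K1 q a b c d, daha_T1 q a b c d}"
      using \<phi> by (simp add: UNIV AW_embedding_def)
    then show ?thesis
      using \<phi> alg_hom_image[of \<phi> ?\<rho> ?R] by (simp only: AW_embedding_def AW_def)
  qed
  ultimately show ?thesis by simp
qed

end
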